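(* Let $G$ be a simple connected graph with $n\geq 3$ vertices and $m$ edges. Let $n_i$ denote the number of vertices of $G$ with edge neighborhood degree $i$, and let $\delta$ and $\Delta$ denote the minimum and maximum edge neighborhood degrees of $G$, respectively. Let $M_1=M_1(G)$ and let $a\in\mathbb{R}\setminus\{0,1\}$. Then the following statements hold. (1) \[KB^a(G)=n\delta^a+(2M_1-4m-n\delta)\bigl((\delta+1)^a-\delta^a\bigr)+\sum_{i=2}^{\Delta-\delta}n_{\delta+i}\left[(\delta+i)^a-\delta^a-i\bigl((\delta+1)^a-\delta^a\bigr)\right].\] If $a<0$ or $a>1$, the coefficients $(\delta+i)^a-\delta^a-i((\delta+1)^a-\delta^a)$ are nonnegative for $2\leq i\leq\Delta-\delta$; if $0<a<1$, they are nonpositive. (2) If $a>1$, then \[\ln\left[\prod_{v\in V(G)}S_e(v)^a\right]=a\left[n\ln\delta+(2M_1-4m-n\delta)(\ln(\delta+1)-\ln\delta)+\sum_{i=2}^{\Delta-\delta}n_{\delta+i}\bigl(\ln(\delta+i)-\ln\delta-i(\ln(\delta+1)-\ln\delta)\bigr)\right].\] Moreover, the coefficients $\ln(\delta+i)-\ln\delta-i(\ln(\delta+1)-\ln\delta)$ of $n_{\delta+i}$ are nonpositive for $2\leq i\leq\Delta-\delta$.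
   Context: Graphs are finite. For a simple graph $G$ with vertex set $V(G)$ and edge set $E(G)$, $d(u)$ denotes the degree of a vertex $u$. The degree of an edge $e=uv$ is $d_G(e)=d(u)+d(v)-2$. The edge neighborhood degree $S_e(v)$ of a vertex $v$ is the sum of the degrees $d_G(e)$ of all edges $e$ incident to $v$. The first Zagreb index is $M_1(G)=\sum_{u\in V(G)}d(u)^2$. For real $a\neq 0,1$, the general Kulli-Basava index is $KB^a(G)=\sum_{v\in V(G)}S_e(v)^a$, and the general multiplicative Kulli-Basava index is $\prod_{v\in V(G)}S_e(v)^a$. Empty sums are zero. *)

theory Defs
  imports Complex_Main
begin

locale simple_graph =
  fixes V :: "'a set" and E :: "'a set set"
  assumes finite_verts: "finite V"
    and edges_two_verts: "e \<in> E \<Longrightarrow> e \<subseteq> V \<and> card e = 2"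

definition connected_graph :: "'a set \<Rightarrow> 'a set set \<Rightarrow> bool" where
  "connected_graph V E \<longleftrightarrow>
     V \<noteq> {} \<and> (\<forall>u\<in>V. \<forall>v\<in>V. (u, v) \<in> {(x, y). {x, y} \<in> E}\<^sup>*)"

definition degree :: "'a set set \<Rightarrow> 'a \<Rightarrow> nat" where
  "degree E u = card {e \<in> E. u \<in> e}"

text \<open>For an edge \<open>e = {u, v}\<close> of a simple graph the sum is \<open>d(u) + d(v)\<close>. Both ends
  have degree at least 1, so the subtraction on \<^typ>\<open>nat\<close> does not truncate.\<close>

definition edge_degree :: "'a set set \<Rightarrow> 'a set \<Rightarrow> nat" where
  "edge_degree E e = (\<Sum>u\<in>e. degree E u) - 2"

definition edge_nbhd_degree :: "'a set set \<Rightarrow> 'a \<Rightarrow> nat" where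
  "edge_nbhd_degree E v = (\<Sum>e \<in> {e \<in> E. v \<in> e}. edge_degree E e)"

definition min_edge_nbhd_degree :: "'a set \<Rightarrow> 'a set set \<Rightarrow> nat" where
  "min_edge_nbhd_degree V E = Min (edge_nbhd_degree E ` V)"

definition max_edge_nbhd_degree :: "'a set \<Rightarrow> 'a set set \<Rightarrow> nat" where
  "max_edge_nbhd_degree V E = Max (edge_nbhd_degree E ` V)"

definition num_edge_nbhd_degree :: "'a set \<Rightarrow> 'a set set \<Rightarrow> nat \<Rightarrow> nat" where
  "num_edge_nbhd_degree V E i = card {v \<in> V. edge_nbhd_degree E v = i}"

definition first_zagreb :: "'a set \<Rightarrow> 'a set set \<Rightarrow> nat" where
  "first_zagreb V E = (\<Sum>u\<in>V. (degree E u)\<^sup>2)"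

text \<open>In a connected graph with at least 3 vertices every edge neighborhood degree is
  positive, so the convention \<open>0 powr a = 0\<close> plays no role there.\<close>

definition kulli_basava :: "real \<Rightarrow> 'a set \<Rightarrow> 'a set set \<Rightarrow> real" where
  "kulli_basava a V E = (\<Sum>v\<in>V. real (edge_nbhd_degree E v) powr a)"

definition mult_kulli_basava :: "real \<Rightarrow> 'a set \<Rightarrow> 'a set set \<Rightarrow> real" where
  "mult_kulli_basava a V E = (\<Prod>v\<in>V. real (edge_nbhd_degree E v) powr a)"

end

theory Submission
  imports Defs "HOL-Analysis.Convex"
begin

text \<open>
  Write \<open>S v\<close> for the edge neighborhood degree of \<open>v\<close>. Both expansions are instances of one
  identity that holds for every function \<open>f\<close>. Let
  \<open>g i = f (\<delta> + i) - f \<delta> - i (f (\<delta> + 1) - f \<delta>)\<close> be the deviation of \<open>f\<close> from the line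
  through its values at \<open>\<delta>\<close> and \<open>\<delta> + 1\<close>. By construction
  \<open>f (S v) = f \<delta> + (S v - \<delta>) (f (\<delta> + 1) - f \<delta>) + g (S v - \<delta>)\<close> for each vertex \<open>v\<close>.
  Summed over all vertices, the first two terms involve \<open>S\<close> only through its total,
  and the third, grouped by the value of \<open>S v\<close>, becomes a sum over \<open>i\<close> that starts at 2 because
  \<open>g 0 = g 1 = 0\<close> (lemma \<open>sum_expansion_about_min\<close>).

  Counting incidences gives the total: each edge contributes its degree at both ends, so
  \<open>\<Sum>S = 2 \<Sum>d(e)\<close>, while \<open>d(u) + d(v)\<close> summed over all edges \<open>uv\<close> collects \<open>d(u)\<close> once per edge
  at \<open>u\<close>, which is \<open>M\<^sub>1\<close>. Hence \<open>\<Sum>S = 2 M\<^sub>1 - 4 m\<close> (lemma \<open>sum_edge_nbhd_degree\<close>).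

  Part (1) is the case \<open>f x = x powr a\<close>. Part (2) is the case \<open>f = ln\<close>, since the logarithm of
  the product is \<open>a\<close> times the sum of the \<open>ln (S v)\<close>; this uses that each \<open>S v\<close> is positive,
  which follows from connectedness with at least three vertices (lemma
  \<open>edge_nbhd_degree_pos\<close>). On the positive reals \<open>f\<close> is convex or concave, and this decides the
  sign of \<open>g i\<close>: beyond the ends of a chord, a convex function lies on or above the line through
  the chord and a concave one on or below it (lemmas \<open>convex_on_above_unit_chord\<close> and
  \<open>concave_on_below_unit_chord\<close>).
\<close>

section \<open>Expansion of a sum about the minimum\<close>

lemma sum_expansion_about_min:
  fixes f :: "real \<Rightarrow> real" and S :: "'v \<Rightarrow> nat"
  assumes "finite V" and bounds: "\<And>v. v \<in> V \<Longrightarrow> \<delta> \<le> S v \<and> S v \<le> \<Delta>"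
  shows "(\<Sum>v\<in>V. f (real (S v))) =
      real (card V) * f (real \<delta>)
      + (real (\<Sum>v\<in>V. S v) - real (card V) * real \<delta>) * (f (real \<delta> + 1) - f (real \<delta>))
      + (\<Sum>i = 2..\<Delta> - \<delta>. real (card {v \<in> V. S v = \<delta> + i})
          * (f (real \<delta> + real i) - f (real \<delta>) - real i * (f (real \<delta> + 1) - f (real \<delta>))))"
proof -
  define c where "c = f (real \<delta> + 1) - f (real \<delta>)"
  define g where "g i = f (real \<delta> + real i) - f (real \<delta>) - real i * c" for i :: nat
  have g01: "g 0 = 0" "g 1 = 0"
    by (simp_all add: g_def c_def)
  have "f (real (S v)) = f (real \<delta>) + (real (S v) - real \<delta>) * c + g (S v - \<delta>)" if "v \<in> V" for v
    using bounds[OF that] by (simp add: g_def of_nat_diff)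
  then have "(\<Sum>v\<in>V. f (real (S v)))
      = (\<Sum>v\<in>V. f (real \<delta>) + (real (S v) - real \<delta>) * c + g (S v - \<delta>))"
    by simp
  also have "\<dots> = real (card V) * f (real \<delta>)
      + (real (\<Sum>v\<in>V. S v) - real (card V) * real \<delta>) * c + (\<Sum>v\<in>V. g (S v - \<delta>))"
    by (simp add: sum.distrib sum_subtractf flip: sum_distrib_right)
  also have "(\<Sum>v\<in>V. g (S v - \<delta>)) = (\<Sum>i\<le>\<Delta> - \<delta>. \<Sum>v | v \<in> V \<and> S v - \<delta> = i. g (S v - \<delta>))"
    using bounds \<open>finite V\<close> by (intro sum.group[symmetric]) (auto intro: diff_le_mono)
  also have "\<dots> = (\<Sum>i\<le>\<Delta> - \<delta>. real (card {v \<in> V. S v = \<delta> + i}) * g i)"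
  proof (intro sum.cong refl)
    fix i
    have "{v \<in> V. S v - \<delta> = i} = {v \<in> V. S v = \<delta> + i}"
      using bounds by fastforce
    then show "(\<Sum>v | v \<in> V \<and> S v - \<delta> = i. g (S v - \<delta>)) = real (card {v \<in> V. S v = \<delta> + i}) * g i"
      by simp
  qed
  also have "\<dots> = (\<Sum>i = 2..\<Delta> - \<delta>. real (card {v \<in> V. S v = \<delta> + i}) * g i)"
  proof (intro sum.mono_neutral_right ballI)
    fix i assume "i \<in> {..\<Delta> - \<delta>} - {2..\<Delta> - \<delta>}"
    then have "i = 0 \<or> i = 1" by auto
    then show "real (card {v \<in> V. S v = \<delta> + i}) * g i = 0"
      using g01 by auto
  qed auto
  finally show ?thesis
    by (simp add: g_def c_def)
qed

section \<open>Convexity and the sign of the coefficients\<close>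

text \<open>
  The point \<open>x + 1\<close> is the convex combination of \<open>x\<close> and \<open>x + i\<close> with weights \<open>1 - 1/i\<close> and
  \<open>1/i\<close>; the convexity inequality there, multiplied by \<open>i\<close>, is the claim.
\<close>

lemma convex_on_above_unit_chord:
  fixes f :: "real \<Rightarrow> real"
  assumes "convex_on {0<..} f" and "x > 0" and "i \<ge> 1"
  shows "f (x + i) - f x - i * (f (x + 1) - f x) \<ge> 0"
proof -
  have "f ((1 - 1 / i) *\<^sub>R x + (1 / i) *\<^sub>R (x + i)) \<le> (1 - 1 / i) * f x + 1 / i * f (x + i)"
    using assms by (intro convex_onD[OF assms(1)]) auto
  moreover have "(1 - 1 / i) *\<^sub>R x + (1 / i) *\<^sub>R (x + i) = x + 1"
    using assms by (simp add: field_simps)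
  ultimately have "i * f (x + 1) \<le> i * ((1 - 1 / i) * f x + 1 / i * f (x + i))"
    using assms by (intro mult_left_mono) auto
  also have "\<dots> = (i - 1) * f x + f (x + i)"
    using assms by (simp add: field_simps)
  finally show ?thesis
    by (simp add: algebra_simps)
qed

lemma concave_on_below_unit_chord:
  fixes f :: "real \<Rightarrow> real"
  assumes "concave_on {0<..} f" and "x > 0" and "i \<ge> 1"
  shows "f (x + i) - f x - i * (f (x + 1) - f x) \<le> 0"
  using convex_on_above_unit_chord[of "\<lambda>x. - f x" x i] assms
  by (simp add: concave_on_def algebra_simps)

lemma powr_second_derivative:
  fixes a x :: real
  assumes "x > 0"
  shows "((\<lambda>x. x powr a) has_real_derivative a * x powr (a - 1)) (at x)"
    and "((\<lambda>x. a * x powr (a - 1)) has_real_derivative a * (a - 1) * x powr (a - 2)) (at x)"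
  using assms by (auto intro!: derivative_eq_intros simp: field_simps)

lemma powr_convex_on_pos:
  fixes a :: real
  assumes "a \<le> 0 \<or> a \<ge> 1"
  shows "convex_on {0<..} (\<lambda>x. x powr a)"
proof (rule f''_ge0_imp_convex)
  have "a * (a - 1) \<ge> 0"
    using assms by (auto simp: zero_le_mult_iff)
  then show "a * (a - 1) * x powr (a - 2) \<ge> 0" for x
    by simp
qed (auto intro: powr_second_derivative)

lemma powr_concave_on_pos:
  fixes a :: real
  assumes "0 \<le> a" and "a \<le> 1"
  shows "concave_on {0<..} (\<lambda>x. x powr a)"
proof (rule f''_le0_imp_concave)
  have "a * (a - 1) \<le> 0"
    using assms by (auto simp: mult_le_0_iff)
  then show "a * (a - 1) * x powr (a - 2) \<le> 0" for x
    by (simp add: mult_nonpos_nonneg)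
qed (auto intro: powr_second_derivative)

section \<open>The sum of the edge neighborhood degrees\<close>

context simple_graph
begin

lemma finite_edges: "finite E"
proof (rule finite_subset)
  show "E \<subseteq> Pow V" using edges_two_verts by auto
qed (simp add: finite_verts)

lemma edge_verts_finite: "e \<in> E \<Longrightarrow> finite e"
  using edges_two_verts finite_verts finite_subset by blast

lemma degree_pos: "e \<in> E \<Longrightarrow> u \<in> e \<Longrightarrow> degree E u \<ge> 1"
  using finite_edges by (auto simp: degree_def Suc_le_eq card_gt_0_iff)

lemma sum_over_incidences:
  fixes h :: "'a \<Rightarrow> 'a set \<Rightarrow> nat"
  shows "(\<Sum>u\<in>V. \<Sum>e | e \<in> E \<and> u \<in> e. h u e) = (\<Sum>e\<in>E. \<Sum>u\<in>e. h u e)"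
proof -
  have "(\<Sum>u\<in>V. \<Sum>e | e \<in> E \<and> u \<in> e. h u e) = (\<Sum>e\<in>E. \<Sum>u | u \<in> V \<and> u \<in> e. h u e)"
    using finite_verts finite_edges by (rule sum.swap_restrict)
  also have "\<dots> = (\<Sum>e\<in>E. \<Sum>u\<in>e. h u e)"
  proof (intro sum.cong refl)
    fix e assume "e \<in> E"
    then show "{u. u \<in> V \<and> u \<in> e} = e" using edges_two_verts by auto
  qed
  finally show ?thesis .
qed

lemma edge_degree_add_2:
  assumes "e \<in> E"
  shows "edge_degree E e + 2 = (\<Sum>u\<in>e. degree E u)"
proof -
  have "2 = (\<Sum>u\<in>e. 1::nat)"
    using edges_two_verts[OF assms] by simp
  also have "\<dots> \<le> (\<Sum>u\<in>e. degree E u)"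
    using degree_pos[OF assms] by (rule sum_mono)
  finally show ?thesis
    by (simp add: edge_degree_def)
qed

lemma first_zagreb_eq_sum_edges: "first_zagreb V E = (\<Sum>e\<in>E. \<Sum>u\<in>e. degree E u)"
proof -
  have "first_zagreb V E = (\<Sum>u\<in>V. \<Sum>e | e \<in> E \<and> u \<in> e. degree E u)"
    by (simp add: first_zagreb_def power2_eq_square degree_def)
  then show ?thesis
    unfolding sum_over_incidences .
qed

lemma sum_edge_nbhd_degree:
  "(\<Sum>v\<in>V. edge_nbhd_degree E v) + 4 * card E = 2 * first_zagreb V E"
proof -
  have "(\<Sum>v\<in>V. edge_nbhd_degree E v) = (\<Sum>e\<in>E. \<Sum>u\<in>e. edge_degree E e)"
    by (simp add: edge_nbhd_degree_def sum_over_incidences)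
  also have "\<dots> = 2 * (\<Sum>e\<in>E. edge_degree E e)"
    using edges_two_verts by (simp add: sum_distrib_left)
  finally have "(\<Sum>v\<in>V. edge_nbhd_degree E v) + 4 * card E = 2 * (\<Sum>e\<in>E. edge_degree E e + 2)"
    unfolding sum.distrib by simp
  also have "\<dots> = 2 * first_zagreb V E"
    unfolding first_zagreb_eq_sum_edges using edge_degree_add_2 by (metis (mono_tags, lifting) sum.cong)
  finally show ?thesis .
qed

section \<open>Positivity of the edge neighborhood degrees\<close>

text \<open>If no edge left \<open>X\<close>, every vertex reachable from \<open>x\<close> would lie in \<open>X\<close>, including \<open>y\<close>.\<close>

lemma connected_crossing_edge:
  assumes conn: "connected_graph V E"
    and "x \<in> X" "x \<in> V" and "y \<in> V" "y \<notin> X"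
  obtains u w where "u \<in> X" "w \<notin> X" "{u, w} \<in> E"
proof -
  have "(x, y) \<in> {(x, y). {x, y} \<in> E}\<^sup>*"
    using assms by (auto simp: connected_graph_def)
  then have "y \<in> X" if "\<And>u w. {u, w} \<in> E \<Longrightarrow> u \<in> X \<Longrightarrow> w \<in> X"
    by (induction rule: rtrancl_induct) (use that \<open>x \<in> X\<close> in auto)
  with \<open>y \<notin> X\<close> show thesis using that by blast
qed

text \<open>
  Let \<open>{v, w}\<close> be an edge at \<open>v\<close>. Since a third vertex exists, a second edge leaves \<open>{v, w}\<close> and
  raises the degree of one of its ends to at least 2. So \<open>{v, w}\<close> has positive degree, and it
  contributes to the sum at \<open>v\<close>.
\<close>

lemma edge_nbhd_degree_pos:
  assumes conn: "connected_graph V E" and "card V \<ge> 3" and "v \<in> V"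
  shows "edge_nbhd_degree E v > 0"
proof -
  have third: "\<exists>y\<in>V. y \<notin> {v, w}" for w
  proof (rule ccontr)
    assume "\<not> ?thesis"
    then have "V \<subseteq> {v, w}" by blast
    then have "card V \<le> card {v, w}" by (intro card_mono) auto
    also have "\<dots> \<le> 2" by (simp add: card_insert_if)
    finally show False using \<open>card V \<ge> 3\<close> by simp
  qed
  obtain y where y: "y \<in> V" "y \<notin> {v}"
    using third[of v] by auto
  obtain w where w: "w \<noteq> v" "{v, w} \<in> E"
    using connected_crossing_edge[OF conn _ \<open>v \<in> V\<close> y] by auto
  obtain z where z: "z \<in> V" "z \<notin> {v, w}"
    using third[of w] by auto
  obtain u t where ut: "u \<in> {v, w}" "t \<notin> {v, w}" "{u, t} \<in> E"
    using connected_crossing_edge[OF conn _ \<open>v \<in> V\<close> z] by auto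
  have "card {{v, w}, {u, t}} \<le> degree E u"
    unfolding degree_def using ut w finite_edges by (intro card_mono) auto
  moreover have "{v, w} \<noteq> {u, t}" using ut by auto
  ultimately have "degree E u \<ge> 2" by simp
  moreover have "degree E v \<ge> 1" "degree E w \<ge> 1"
    using degree_pos[OF w(2)] by auto
  ultimately have "degree E v + degree E w \<ge> 3"
    using ut(1) by auto
  then have "edge_degree E {v, w} > 0"
    using w by (simp add: edge_degree_def)
  also have "edge_degree E {v, w} \<le> edge_nbhd_degree E v"
    unfolding edge_nbhd_degree_def using w finite_edges by (intro member_le_sum) auto
  finally show ?thesis .
qed

end

section \<open>The expansions of the two Kulli-Basava indices\<close>

theorem theorem3p7:
  fixes V :: "'a set" and E :: "'a set set" and a :: real
    and n m M\<^sub>1 \<delta> \<Delta> :: nat and N :: "nat \<Rightarrow> nat"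
  assumes "simple_graph V E" and "connected_graph V E"
    and "n = card V" and "n \<ge> 3" and "m = card E"
    and "N = num_edge_nbhd_degree V E"
    and "\<delta> = min_edge_nbhd_degree V E" and "\<Delta> = max_edge_nbhd_degree V E"
    and "M\<^sub>1 = first_zagreb V E"
    and "a \<noteq> 0" and "a \<noteq> 1"
  shows
    "(kulli_basava a V E =
        real n * real \<delta> powr a
        + (2 * real M\<^sub>1 - 4 * real m - real n * real \<delta>)
            * ((real \<delta> + 1) powr a - real \<delta> powr a)
        + (\<Sum>i = 2..\<Delta> - \<delta>. real (N (\<delta> + i))
            * ((real \<delta> + real i) powr a - real \<delta> powr a
               - real i * ((real \<delta> + 1) powr a - real \<delta> powr a)))
      \<and> (a < 0 \<or> a > 1 \<longrightarrow>
          (\<forall>i\<in>{2..\<Delta> - \<delta>}.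
             (real \<delta> + real i) powr a - real \<delta> powr a
               - real i * ((real \<delta> + 1) powr a - real \<delta> powr a) \<ge> 0))
      \<and> (0 < a \<and> a < 1 \<longrightarrow>
          (\<forall>i\<in>{2..\<Delta> - \<delta>}.
             (real \<delta> + real i) powr a - real \<delta> powr a
               - real i * ((real \<delta> + 1) powr a - real \<delta> powr a) \<le> 0)))
     \<and> (a > 1 \<longrightarrow>
        ln (mult_kulli_basava a V E) =
          a * (real n * ln (real \<delta>)
               + (2 * real M\<^sub>1 - 4 * real m - real n * real \<delta>)
                   * (ln (real \<delta> + 1) - ln (real \<delta>))
               + (\<Sum>i = 2..\<Delta> - \<delta>. real (N (\<delta> + i))
                   * (ln (real \<delta> + real i) - ln (real \<delta>)
                      - real i * (ln (real \<delta> + 1) - ln (real \<delta>)))))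
        \<and> (\<forall>i\<in>{2..\<Delta> - \<delta>}.
             ln (real \<delta> + real i) - ln (real \<delta>)
               - real i * (ln (real \<delta> + 1) - ln (real \<delta>)) \<le> 0))"
proof -
  interpret simple_graph V E by (rule assms(1))
  let ?S = "edge_nbhd_degree E"
  have S_pos: "?S v > 0" if "v \<in> V" for v
    using edge_nbhd_degree_pos[OF assms(2) _ that] assms(3,4) by simp
  have bounds: "\<delta> \<le> ?S v \<and> ?S v \<le> \<Delta>" if "v \<in> V" for v
    using that finite_verts
    by (simp add: assms(7,8) min_edge_nbhd_degree_def max_edge_nbhd_degree_def)
  have "V \<noteq> {}"
    using assms(2) by (simp add: connected_graph_def)
  then have "\<delta> \<in> ?S ` V"
    unfolding assms(7) min_edge_nbhd_degree_def using finite_verts by (intro Min_in) auto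
  then have \<delta>_pos: "real \<delta> > 0"
    using S_pos by auto
  have total: "real (\<Sum>v\<in>V. ?S v) = 2 * real M\<^sub>1 - 4 * real m"
    using arg_cong[OF sum_edge_nbhd_degree, of real] by (simp add: assms(5,9))
  have expansion: "(\<Sum>v\<in>V. f (real (?S v))) =
      real n * f (real \<delta>)
      + (2 * real M\<^sub>1 - 4 * real m - real n * real \<delta>) * (f (real \<delta> + 1) - f (real \<delta>))
      + (\<Sum>i = 2..\<Delta> - \<delta>. real (N (\<delta> + i))
          * (f (real \<delta> + real i) - f (real \<delta>) - real i * (f (real \<delta> + 1) - f (real \<delta>))))"
    for f :: "real \<Rightarrow> real"
    using sum_expansion_about_min[where S = ?S and f = f, OF finite_verts bounds]
    unfolding total assms(3,6) num_edge_nbhd_degree_def .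
  have "ln (mult_kulli_basava a V E) = (\<Sum>v\<in>V. ln (real (?S v) powr a))"
    unfolding mult_kulli_basava_def using finite_verts S_pos by (intro ln_prod) auto
  also have "\<dots> = a * (\<Sum>v\<in>V. ln (real (?S v)))"
    using S_pos by (simp add: ln_powr sum_distrib_left)
  finally have log_product: "ln (mult_kulli_basava a V E) = a * (\<Sum>v\<in>V. ln (real (?S v)))" .
  show ?thesis
  proof (intro conjI impI ballI)
    show "kulli_basava a V E =
        real n * real \<delta> powr a
        + (2 * real M\<^sub>1 - 4 * real m - real n * real \<delta>)
            * ((real \<delta> + 1) powr a - real \<delta> powr a)
        + (\<Sum>i = 2..\<Delta> - \<delta>. real (N (\<delta> + i))
            * ((real \<delta> + real i) powr a - real \<delta> powr a
               - real i * ((real \<delta> + 1) powr a - real \<delta> powr a)))"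
      unfolding kulli_basava_def by (rule expansion)
  next
    fix i assume "a < 0 \<or> a > 1" and "i \<in> {2..\<Delta> - \<delta>}"
    then show "(real \<delta> + real i) powr a - real \<delta> powr a
        - real i * ((real \<delta> + 1) powr a - real \<delta> powr a) \<ge> 0"
      using \<delta>_pos by (intro convex_on_above_unit_chord powr_convex_on_pos) auto
  next
    fix i assume "0 < a \<and> a < 1" and "i \<in> {2..\<Delta> - \<delta>}"
    then show "(real \<delta> + real i) powr a - real \<delta> powr a
        - real i * ((real \<delta> + 1) powr a - real \<delta> powr a) \<le> 0"
      using \<delta>_pos by (intro concave_on_below_unit_chord powr_concave_on_pos) auto
  next
    show "ln (mult_kulli_basava a V E) =
        a * (real n * ln (real \<delta>)
             + (2 * real M\<^sub>1 - 4 * real m - real n * real \<delta>)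
                 * (ln (real \<delta> + 1) - ln (real \<delta>))
             + (\<Sum>i = 2..\<Delta> - \<delta>. real (N (\<delta> + i))
                 * (ln (real \<delta> + real i) - ln (real \<delta>)
                    - real i * (ln (real \<delta> + 1) - ln (real \<delta>)))))"
      unfolding log_product expansion ..
  next
    fix i assume "i \<in> {2..\<Delta> - \<delta>}"
    then show "ln (real \<delta> + real i) - ln (real \<delta>)
        - real i * (ln (real \<delta> + 1) - ln (real \<delta>)) \<le> 0"
      using \<delta>_pos by (intro concave_on_below_unit_chord ln_concave) auto
  qed
qed

end
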